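(* Let $\mathsf{K},\mathsf{L}$ be kernels on $S$. Then the following statements are equivalent. (i) $\mathsf{K}$ is an extreme point of $[\mathsf{0},\mathsf{K}+\mathsf{L}]$. (ii) $\mathrm{ex}[\mathsf{K},\mathsf{K}+\mathsf{L}]\subseteq\mathrm{ex}[\mathsf{0},\mathsf{K}+\mathsf{L}]$. Consequently (replacing $\mathsf{L}$ with $\mathsf{L}-\mathsf{K}$), if $\mathsf{K}\prec\mathsf{L}$, then $$\mathsf{K}\in\mathrm{ex}[\mathsf{0},\mathsf{L}]\iff\mathrm{ex}[\mathsf{K},\mathsf{L}]\subseteq\mathrm{ex}[\mathsf{0},\mathsf{L}].$$
   Context: Let $S$ be a non-empty set and $\mathfrak{E}$ a complex Banach space with topological dual $\mathfrak{E}^{*}$. The dual pairing $\langle\cdot,\cdot\rangle:\mathfrak{E}\times\mathfrak{E}^{*}\to\mathbb{C}$ is taken linear in the first and conjugate linear in the second variable (the vector space structure of $\mathfrak{E}^*$ is chosen accordingly). $\mathbf{B}(\mathfrak{E},\mathfrak{E}^{*})$ is the space of bounded linear operators from $\mathfrak{E}$ to $\mathfrak{E}^*$. $\mathfrak{X}$ is the complex linear space of finitely supported functions $f:S\to\mathfrak{E}$. A kernel on $S$ is a function $\mathsf{K}:S\times S\to\mathbf{B}(\mathfrak{E},\mathfrak{E}^{*})$ with $\sum_{s,t\in S}\langle f(t),\mathsf{K}(s,t)f(s)\rangle\ge0$ for all $f\in\mathfrak{X}$. Linear operations on kernels are pointwise; $\mathsf{0}$ is the zero kernel. For kernels write $\mathsf{K}\prec\mathsf{L}$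 if $\sum_{s,t\in S}\langle f(t),\mathsf{K}(s,t)f(s)\rangle\le\sum_{s,t\in S}\langle f(t),\mathsf{L}(s,t)f(s)\rangle$ for all $f\in\mathfrak{X}$. For kernels $\mathsf{K}_1\prec\mathsf{K}_2$, $[\mathsf{K}_1,\mathsf{K}_2]$ is the convex set of all kernels $\mathsf{U}$ on $S$ with $\mathsf{K}_1\prec\mathsf{U}\prec\mathsf{K}_2$, and $\mathrm{ex}[\mathsf{K}_1,\mathsf{K}_2]$ is the set of its extreme points. *)

theory Defs
  imports
    "HOL-Analysis.Analysis"
    "HOL-Library.Function_Algebras"
    "HOL-Library.Complex_Order"
begin

class complex_banach = banach +
  fixes scaleC :: "complex \<Rightarrow> 'a \<Rightarrow> 'a"  (infixr \<open>*\<^sub>C\<close> 75)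
  assumes scaleC_add_right: "c *\<^sub>C (x + y) = c *\<^sub>C x + c *\<^sub>C y"
    and scaleC_add_left: "(c + d) *\<^sub>C x = c *\<^sub>C x + d *\<^sub>C x"
    and scaleC_scaleC: "c *\<^sub>C (d *\<^sub>C x) = (c * d) *\<^sub>C x"
    and scaleC_of_real: "complex_of_real r *\<^sub>C x = r *\<^sub>R x"
    and norm_scaleC: "norm (c *\<^sub>C x) = cmod c * norm x"

instantiation complex :: complex_banach
begin

definition scaleC_complex :: "complex \<Rightarrow> complex \<Rightarrow> complex"
  where "scaleC_complex c x = c * x"

instance
  by standard (simp_all add: scaleC_complex_def algebra_simps norm_mult scaleR_conv_of_real)

end

text \<open>
  The pointwise real vector space structure on functions, so that \<open>extreme_point_of\<close> applies to
  sets of kernels; addition, zero and subtraction come from the library.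
\<close>

instantiation "fun" :: (type, real_vector) real_vector
begin

definition scaleR_fun :: "real \<Rightarrow> ('a \<Rightarrow> 'b) \<Rightarrow> 'a \<Rightarrow> 'b"
  where "scaleR_fun r f = (\<lambda>x. r *\<^sub>R f x)"

instance
  by standard (simp_all add: scaleR_fun_def fun_eq_iff scaleR_add_right scaleR_add_left)

end

lemma scaleR_fun_apply [simp]: "(r *\<^sub>R f) x = r *\<^sub>R f x"
  by (simp add: scaleR_fun_def)

text \<open>
  The library type of bounded operators is that of bounded real-linear maps. The topological dual
  consists of its complex-linear members. The pairing is evaluation; for it to be conjugate linear
  in the second variable, the scalar \<open>c\<close> has to act on functionals as multiplication by \<open>cnj c\<close>.
\<close>

definition topological_dual :: "('a::complex_banach \<Rightarrow>\<^sub>L complex) set"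
  where "topological_dual = {\<phi>. \<forall>c x. blinfun_apply \<phi> (c *\<^sub>C x) = c * blinfun_apply \<phi> x}"

definition scaleC_dual :: "complex \<Rightarrow> ('a::complex_banach \<Rightarrow>\<^sub>L complex) \<Rightarrow> ('a \<Rightarrow>\<^sub>L complex)"
  where "scaleC_dual c \<phi> = blinfun_mult_right (cnj c) o\<^sub>L \<phi>"

definition dual_pairing :: "'a::complex_banach \<Rightarrow> ('a \<Rightarrow>\<^sub>L complex) \<Rightarrow> complex"
  where "dual_pairing x \<phi> = blinfun_apply \<phi> x"

definition operators_to_dual :: "('a::complex_banach \<Rightarrow>\<^sub>L ('a \<Rightarrow>\<^sub>L complex)) set"
  where "operators_to_dual = {T.
    (\<forall>x. blinfun_apply T x \<in> topological_dual) \<and>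
    (\<forall>c x. blinfun_apply T (c *\<^sub>C x) = scaleC_dual c (blinfun_apply T x))}"

text \<open>
  The set \<open>S\<close> is the type \<open>'s\<close>. A kernel in the sense of the mathematics is a member of this
  function type that satisfies \<open>is_kernel\<close> below.
\<close>

type_synonym ('s, 'a) operator_kernel = "'s \<Rightarrow> 's \<Rightarrow> ('a \<Rightarrow>\<^sub>L ('a \<Rightarrow>\<^sub>L complex))"

definition finitely_supported :: "('s \<Rightarrow> 'a::complex_banach) set"
  where "finitely_supported = {f. finite {s. f s \<noteq> 0}}"

text \<open>The terms of the double sum vanish as soon as one index lies outside the support of \<open>f\<close>.\<close>

definition kernel_sum ::
    "('s, 'a::complex_banach) operator_kernel \<Rightarrow> ('s \<Rightarrow> 'a) \<Rightarrow> complex"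
  where "kernel_sum K f =
    (\<Sum>s | f s \<noteq> 0. \<Sum>t | f t \<noteq> 0. dual_pairing (f t) (blinfun_apply (K s t) (f s)))"

text \<open>
  The order on complex numbers is the one with \<open>0 \<le> z\<close> iff \<open>z\<close> is real and nonnegative.
\<close>

definition is_kernel :: "('s, 'a::complex_banach) operator_kernel \<Rightarrow> bool"
  where "is_kernel K \<longleftrightarrow>
    (\<forall>s t. K s t \<in> operators_to_dual) \<and> (\<forall>f\<in>finitely_supported. 0 \<le> kernel_sum K f)"

definition kernel_le ::
    "('s, 'a::complex_banach) operator_kernel \<Rightarrow> ('s, 'a) operator_kernel \<Rightarrow> bool"
    (infix \<open>\<preceq>\<^sub>K\<close> 50)
  where "K \<preceq>\<^sub>K L \<longleftrightarrow> (\<forall>f\<in>finitely_supported. kernel_sum K f \<le> kernel_sum L f)"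

definition kernel_interval ::
    "('s, 'a::complex_banach) operator_kernel \<Rightarrow> ('s, 'a) operator_kernel
      \<Rightarrow> ('s, 'a) operator_kernel set"
  where "kernel_interval K\<^sub>1 K\<^sub>2 = {U. is_kernel U \<and> K\<^sub>1 \<preceq>\<^sub>K U \<and> U \<preceq>\<^sub>K K\<^sub>2}"

definition ex_kernel_interval ::
    "('s, 'a::complex_banach) operator_kernel \<Rightarrow> ('s, 'a) operator_kernel
      \<Rightarrow> ('s, 'a) operator_kernel set"
  where "ex_kernel_interval K\<^sub>1 K\<^sub>2 = {U. U extreme_point_of kernel_interval K\<^sub>1 K\<^sub>2}"

end

theory Submission
  imports Defs
begin

text \<open>
  The kernels form a cone \<open>C\<close>, and for kernels \<open>U \<in> [K\<^sub>1, K\<^sub>2]\<close> means that \<open>U\<close>, \<open>U - K\<^sub>1\<close> and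
  \<open>K\<^sub>2 - U\<close> lie in \<open>C\<close>. As \<open>K\<close> is always extreme in \<open>[K, K + L]\<close>, (ii) implies (i). For the converse,
  (i) makes the forms of \<open>K\<close> and \<open>L\<close> mutually singular: every \<open>f\<close> splits as \<open>h + g\<close> with
  \<open>\<langle>h, K h\<rangle>\<close> and \<open>\<langle>g, L g\<rangle>\<close> arbitrarily small. If \<open>U\<close> is extreme in \<open>[K, K + L]\<close> and
  \<open>U \<plusminus> D \<in> [0, K + L]\<close>, then \<open>R = K + L - (U \<plusminus> D)\<close> satisfies \<open>R \<le> 2 L\<close> and \<open>R \<le> K + L\<close>. Evaluating
  the seminorm of \<open>R\<close> along the splitting gives \<open>R \<le> L\<close>, that is \<open>K \<le> U \<plusminus> D\<close>, whence \<open>D = 0\<close>.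
\<close>

section \<open>Extreme points and semidefinite forms\<close>

lemma extreme_point_of_symmetric:
  assumes "x extreme_point_of S" "x + d \<in> S" "x - d \<in> S"
  shows "d = 0"
proof (rule ccontr)
  assume "d \<noteq> 0"
  have ne: "x + d \<noteq> x - d"
  proof
    assume "x + d = x - d"
    then have "d + d = 0" by (simp add: algebra_simps)
    then have "(2::real) *\<^sub>R d = 0" by (simp add: scaleR_2)
    then show False using \<open>d \<noteq> 0\<close> by simp
  qed
  have "x = (1 - 1/2) *\<^sub>R (x + d) + (1/2) *\<^sub>R (x - d)"
    by (simp add: algebra_simps flip: scaleR_add_left)
  then have "x \<in> open_segment (x + d) (x - d)"
    using ne unfolding in_segment by (intro conjI exI[of _ "1/2"]) auto
  then show False
    using assms by (auto simp: extreme_point_of_def)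
qed

text \<open>If \<open>x\<close> were inside a proper segment of \<open>S\<close>, a small multiple
  of the direction of that segment would be a nonzero \<open>d\<close> with \<open>x + d\<close> and
  \<open>x - d\<close> in \<open>S\<close>.\<close>

lemma extreme_point_ofI_symmetric:
  assumes "convex S" "x \<in> S" "\<And>d. x + d \<in> S \<Longrightarrow> x - d \<in> S \<Longrightarrow> d = 0"
  shows "x extreme_point_of S"
  unfolding extreme_point_of_def
proof (intro conjI ballI notI)
  fix a b assume ab: "a \<in> S" "b \<in> S" and "x \<in> open_segment a b"
  then obtain u where "a \<noteq> b" and u: "0 < u" "u < 1" and x: "x = (1 - u) *\<^sub>R a + u *\<^sub>R b"
    by (auto simp: in_segment)
  \<comment> \<open>Shifting the parameter \<open>u\<close> by \<open>m\<close> in either direction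
    keeps it in the unit interval.\<close>
  define m where "m = min u (1 - u)"
  have m: "0 < m" "m \<le> u" "u + m \<le> 1"
    using u by (auto simp: m_def)
  have mem: "(1 - v) *\<^sub>R a + v *\<^sub>R b \<in> S" if "0 \<le> v" "v \<le> 1" for v
    using that ab \<open>convex S\<close> by (simp add: convex_alt)
  have "x + m *\<^sub>R (b - a) = (1 - (u + m)) *\<^sub>R a + (u + m) *\<^sub>R b"
       "x - m *\<^sub>R (b - a) = (1 - (u - m)) *\<^sub>R a + (u - m) *\<^sub>R b"
    by (simp_all add: x algebra_simps)
  then have "m *\<^sub>R (b - a) = 0"
    using mem[of "u + m"] mem[of "u - m"] m u by (intro assms(3)) auto
  then show False using \<open>a \<noteq> b\<close> m by simp
qed (fact \<open>x \<in> S\<close>)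

section \<open>Semidefinite forms and their seminorms\<close>

lemma quadratic_nonneg_discriminant:
  fixes a b c :: real
  assumes "\<And>t. 0 \<le> a + 2 * t * b + t\<^sup>2 * c" and "0 \<le> c"
  shows "b\<^sup>2 \<le> a * c"
proof (cases "c = 0")
  case True
  have "b = 0"
  proof (rule ccontr)
    assume "b \<noteq> 0"
    \<comment> \<open>For this \<open>t\<close> the expression takes the value -1.\<close>
    then show False
      using assms(1)[of "- (a + 1) / (2 * b)"] True by (simp add: field_simps)
  qed
  then show ?thesis using True by simp
next
  case False
  \<comment> \<open>\<open>- b / c\<close> minimises the quadratic; the minimum is
    \<open>a - b\<^sup>2 / c\<close>.\<close>
  then show ?thesis
    using assms(1)[of "- b / c"] assms(2) by (simp add: field_simps power2_eq_square)
qed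

text \<open>The carrier is a subspace because finitely supported functions do not fill their type in
  general. Nonzero null vectors are allowed, so \<open>sqrt (B f f)\<close> is only a
  seminorm.\<close>

locale psd_form =
  fixes X :: "'v::real_vector set" and B :: "'v \<Rightarrow> 'v \<Rightarrow> real"
  assumes subspace: "subspace X"
    and add_left: "\<lbrakk>f \<in> X; g \<in> X; h \<in> X\<rbrakk> \<Longrightarrow> B (f + g) h = B f h + B g h"
    and scale_left: "\<lbrakk>f \<in> X; h \<in> X\<rbrakk> \<Longrightarrow> B (r *\<^sub>R f) h = r * B f h"
    and sym: "\<lbrakk>f \<in> X; h \<in> X\<rbrakk> \<Longrightarrow> B f h = B h f"
    and nonneg: "f \<in> X \<Longrightarrow> 0 \<le> B f f"
begin

lemmas closed = subspace_add[OF subspace] subspace_scale[OF subspace] subspace_diff[OF subspace]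
  subspace_0[OF subspace]

lemma add_right: "\<lbrakk>f \<in> X; g \<in> X; h \<in> X\<rbrakk> \<Longrightarrow> B h (f + g) = B h f + B h g"
  using add_left[of f g h] sym[of h "f + g"] sym[of h f] sym[of h g] closed by simp

lemma scale_right: "\<lbrakk>f \<in> X; h \<in> X\<rbrakk> \<Longrightarrow> B h (r *\<^sub>R f) = r * B h f"
  using scale_left[of f h r] sym[of h "r *\<^sub>R f"] sym[of h f] closed by simp

lemma diff_left: "\<lbrakk>f \<in> X; g \<in> X; h \<in> X\<rbrakk> \<Longrightarrow> B (f - g) h = B f h - B g h"
  using add_left[of f "(-1) *\<^sub>R g" h] scale_left[of g h "-1"] closed(2)[of g "-1"] by simp

lemma diff_right: "\<lbrakk>f \<in> X; g \<in> X; h \<in> X\<rbrakk> \<Longrightarrow> B h (f - g) = B h f - B h g"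
  using diff_left[of f g h] sym[of h "f - g"] sym[of h f] sym[of h g] closed by simp

lemmas bilinear = add_left add_right scale_left scale_right diff_left diff_right

lemma expand:
  assumes "f \<in> X" "g \<in> X"
  shows "B (f + t *\<^sub>R g) (f + t *\<^sub>R g) = B f f + 2 * t * B f g + t\<^sup>2 * B g g"
  using assms sym[of f g] by (simp add: bilinear closed algebra_simps power2_eq_square)

lemma Cauchy_Schwarz:
  assumes "f \<in> X" "g \<in> X"
  shows "(B f g)\<^sup>2 \<le> B f f * B g g"
  using nonneg[of "f + _ *\<^sub>R g"] assms
  by (intro quadratic_nonneg_discriminant) (auto simp: closed expand[symmetric] nonneg)

lemma triangle:
  assumes "f \<in> X" "g \<in> X"
  shows "sqrt (B (f + g) (f + g)) \<le> sqrt (B f f) + sqrt (B g g)"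
proof (rule real_le_lsqrt)
  have "B f g \<le> sqrt (B f f * B g g)"
    using Cauchy_Schwarz[OF assms] by (rule real_le_rsqrt)
  then have "2 * B f g \<le> 2 * (sqrt (B f f) * sqrt (B g g))"
    by (simp add: real_sqrt_mult)
  then show "B (f + g) (f + g) \<le> (sqrt (B f f) + sqrt (B g g))\<^sup>2"
    using expand[OF assms, of 1] nonneg assms by (simp add: power2_sum)
qed (use nonneg assms in auto)

end

section \<open>Mutually singular pairs of forms\<close>

locale psd_form_pair = P: psd_form X P + Q: psd_form X Q
  for X :: "'v::real_vector set" and P Q :: "'v \<Rightarrow> 'v \<Rightarrow> real"
begin

text \<open>The infimum over \<open>g\<close> is the value at \<open>f\<close> of the parallel sum
  of \<open>P\<close> and \<open>Q\<close>; singularity says that the parallel sum vanishes.\<close>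

definition singular :: bool where
  "singular \<longleftrightarrow> (\<forall>f\<in>X. \<forall>\<epsilon>>0. \<exists>g\<in>X. P (f - g) (f - g) + Q g g < \<epsilon>)"

lemma psd_form_add: "psd_form X (\<lambda>f g. P f g + Q f g)"
  by unfold_locales (auto simp: P.subspace P.bilinear Q.bilinear P.sym Q.sym P.nonneg Q.nonneg algebra_simps)

text \<open>
  With \<open>g\<^sub>n\<close> a minimising sequence of \<open>P (f\<^sub>0 - g) (f\<^sub>0 - g) + Q g g\<close>, the forms
  \<open>P (f\<^sub>0 - g\<^sub>n)\<close> and \<open>Q g\<^sub>n\<close> have a common limit, which is the functional sought.
\<close>

lemma common_minorant_if_not_singular:
  assumes "\<not> singular"
  obtains u C f\<^sub>0 where
    "\<And>f g. f \<in> X \<Longrightarrow> g \<in> X \<Longrightarrow> u (f + g) = u f + u g"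
    "\<And>r f. f \<in> X \<Longrightarrow> u (r *\<^sub>R f) = r * u f"
    "0 < C"
    "\<And>f. f \<in> X \<Longrightarrow> (u f)\<^sup>2 \<le> C * P f f"
    "\<And>f. f \<in> X \<Longrightarrow> (u f)\<^sup>2 \<le> C * Q f f"
    "f\<^sub>0 \<in> X" "u f\<^sub>0 \<noteq> (0::real)"
proof -
  interpret S: psd_form X "\<lambda>f g. P f g + Q f g" by (rule psd_form_add)
  obtain f\<^sub>0 \<epsilon> where f0: "f\<^sub>0 \<in> X" and eps: "0 < \<epsilon>"
    and lower: "\<And>g. g \<in> X \<Longrightarrow> \<epsilon> \<le> P (f\<^sub>0 - g) (f\<^sub>0 - g) + Q g g"
    using assms unfolding singular_def by (auto simp: not_less)
  \<comment> \<open>\<open>c\<close> is the parallel sum at \<open>f\<^sub>0\<close>, and \<epsilon>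
    keeps it positive.\<close>
  define q where "q g = P (f\<^sub>0 - g) (f\<^sub>0 - g) + Q g g" for g
  define c where "c = Inf (q ` X)"
  have bdd: "bdd_below (q ` X)"
    using lower by (intro bdd_belowI[of _ \<epsilon>]) (auto simp: q_def)
  have ne: "q ` X \<noteq> {}" using f0 by blast
  have c_le: "c \<le> q g" if "g \<in> X" for g
    unfolding c_def using that bdd by (intro cInf_lower) auto
  have "\<epsilon> \<le> c"
    unfolding c_def using lower ne by (intro cInf_greatest) (auto simp: q_def)
  then have c: "0 < c" using eps by simp
  have "\<exists>g\<in>X. q g < c + inverse (real (Suc n))" for n
  proof -
    have "c < c + inverse (real (Suc n))" by simp
    then show ?thesis
      using cInf_lessD[OF ne] unfolding c_def by blast
  qed
  then obtain g where g: "\<And>n. g n \<in> X" and qg: "\<And>n. q (g n) < c + inverse (real (Suc n))"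
    by metis
  have qlim: "(\<lambda>n. q (g n)) \<longlonglongrightarrow> c"
  proof (rule tendsto_sandwich)
    show "(\<lambda>n. c) \<longlonglongrightarrow> c" by simp
    show "(\<lambda>n. c + inverse (real (Suc n))) \<longlonglongrightarrow> c"
      using tendsto_add[OF tendsto_const LIMSEQ_inverse_real_of_nat, of c] by simp
  qed (use c_le[OF g] less_imp_le[OF qg] in simp_all)
  \<comment> \<open>The parallelogram law for \<open>P + Q\<close>: \<open>q\<close> is a quadratic
    function with this leading part, so near-minimisers are close to each other.\<close>
  have parallelogram: "P (a - b) (a - b) + Q (a - b) (a - b) =
      2 * q a + 2 * q b - 4 * q ((1/2) *\<^sub>R (a + b))" if "a \<in> X" "b \<in> X" for a b
  proof -
    have "P a b = P b a" "Q a b = Q b a" "P f\<^sub>0 a = P a f\<^sub>0" "P f\<^sub>0 b = P b f\<^sub>0"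
      using that f0 P.sym Q.sym by auto
    then show ?thesis
      unfolding q_def using that f0
      by (simp add: P.bilinear Q.bilinear P.closed algebra_simps)
  qed
  have expand_q: "q (a + t *\<^sub>R f) =
      q a + 2 * t * (Q a f - P (f\<^sub>0 - a) f) + t\<^sup>2 * (P f f + Q f f)" if "a \<in> X" "f \<in> X" for a f t
  proof -
    have "f\<^sub>0 - (a + t *\<^sub>R f) = (f\<^sub>0 - a) + (- t) *\<^sub>R f" by simp
    then have "q (a + t *\<^sub>R f) =
       P (f\<^sub>0 - a) (f\<^sub>0 - a) + 2 * (-t) * P (f\<^sub>0 - a) f + (-t)\<^sup>2 * P f f +
       (Q a a + 2 * t * Q a f + t\<^sup>2 * Q f f)"
      unfolding q_def using P.expand[of "f\<^sub>0 - a" f "-t"] Q.expand[of a f t] that f0 P.closed(3)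
      by metis
    then show ?thesis by (simp add: q_def algebra_simps)
  qed
  \<comment> \<open>Near a minimiser the first variation of \<open>q\<close> is small: the
    functionals \<open>Q a\<close> and \<open>P (f\<^sub>0 - a)\<close> almost agree.\<close>
  have first_order: "(Q a f - P (f\<^sub>0 - a) f)\<^sup>2 \<le> (q a - c) * (P f f + Q f f)"
    if "a \<in> X" "f \<in> X" for a f
  proof (rule quadratic_nonneg_discriminant)
    fix t
    show "0 \<le> q a - c + 2 * t * (Q a f - P (f\<^sub>0 - a) f) + t\<^sup>2 * (P f f + Q f f)"
      using c_le[of "a + t *\<^sub>R f"] expand_q[OF that, of t] that P.closed by simp
  qed (use S.nonneg that in auto)
  \<comment> \<open>In the parallelogram identity the value at the midpoint is at least
    \<open>c\<close>, so all multiples of \<open>c\<close> cancel.\<close>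
  have diff_bound: "P (g m - g n) (g m - g n) \<le>
      2 * inverse (real (Suc m)) + 2 * inverse (real (Suc n))" for m n
    using parallelogram[OF g g, of m n] Q.nonneg[of "g m - g n"] qg[of m] qg[of n]
      c_le[of "(1/2) *\<^sub>R (g m + g n)"] g P.closed
    by (smt (verit, best))
  define v where "v n f = P (f\<^sub>0 - g n) f" for n f
  have "Cauchy (\<lambda>n. v n f)" if f: "f \<in> X" for f
  proof (rule metric_CauchyI)
    fix e :: real assume e: "0 < e"
    \<comment> \<open>Chosen so that \<open>\<delta> * P f f < e\<^sup>2\<close>; the summand 1
      guards against \<open>P f f = 0\<close>.\<close>
    define \<delta> where "\<delta> = e\<^sup>2 / (P f f + 1)"
    have "0 < \<delta>" using e P.nonneg[OF f] by (simp add: \<delta>_def)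
    then obtain N where N: "inverse (real (Suc N)) < \<delta> / 4"
      using reals_Archimedean[of "\<delta> / 4"] by auto
    show "\<exists>M. \<forall>m\<ge>M. \<forall>n\<ge>M. dist (v m f) (v n f) < e"
    proof (intro exI allI impI)
      fix m n assume mn: "N \<le> m" "N \<le> n"
      have "P (g m - g n) (g m - g n) \<le> 4 * inverse (real (Suc N))"
      proof -
        have "inverse (real (Suc m)) \<le> inverse (real (Suc N))"
          "inverse (real (Suc n)) \<le> inverse (real (Suc N))"
          using mn by (auto intro!: le_imp_inverse_le)
        then show ?thesis using diff_bound[of m n] by linarith
      qed
      then have "P (g m - g n) (g m - g n) \<le> \<delta>"
        using N by linarith
      then have "P (g m - g n) (g m - g n) * P f f \<le> \<delta> * P f f"
        using P.nonneg[OF f] by (rule mult_right_mono)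
      also have "\<dots> < e\<^sup>2"
        using e P.nonneg[OF f] by (simp add: \<delta>_def field_simps)
      finally have "(P (g m - g n) f)\<^sup>2 < e\<^sup>2"
        using P.Cauchy_Schwarz[of "g m - g n" f] f g P.closed by force
      then have "\<bar>P (g m - g n) f\<bar> < e"
        using e power2_less_imp_less[of "\<bar>P (g m - g n) f\<bar>" e] by simp
      moreover have "v m f - v n f = - P (g m - g n) f"
        unfolding v_def using f f0 g by (simp add: P.bilinear P.closed)
      ultimately show "dist (v m f) (v n f) < e" by (simp add: dist_real_def)
    qed
  qed
  then have conv: "(\<lambda>n. v n f) \<longlonglongrightarrow> lim (\<lambda>n. v n f)" if "f \<in> X" for f
    using that by (simp add: Cauchy_convergent flip: convergent_LIMSEQ_iff)
  define u where "u f = lim (\<lambda>n. v n f)" for f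
  have vu: "(\<lambda>n. v n f) \<longlonglongrightarrow> u f" if "f \<in> X" for f
    unfolding u_def using conv that .
  have err: "(\<lambda>n. Q (g n) f - v n f) \<longlonglongrightarrow> 0" if f: "f \<in> X" for f
  proof -
    have "(\<lambda>n. (Q (g n) f - v n f)\<^sup>2) \<longlonglongrightarrow> 0"
    proof (rule tendsto_sandwich)
      show "(\<lambda>n. 0 :: real) \<longlonglongrightarrow> 0" by simp
      show "(\<lambda>n. (q (g n) - c) * (P f f + Q f f)) \<longlonglongrightarrow> 0"
        using tendsto_mult_left_zero[OF LIM_zero[OF qlim]] .
    qed (use first_order g f in \<open>auto simp: v_def\<close>)
    then show ?thesis by simp
  qed
  have Qu: "(\<lambda>n. Q (g n) f) \<longlonglongrightarrow> u f" if "f \<in> X" for f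
    using tendsto_add[OF err[OF that] vu[OF that]] by simp
  have qc: "q (g n) \<le> c + 1" for n
    using qg[of n] by (smt (verit) inverse_1 le_imp_inverse_le of_nat_1 of_nat_Suc of_nat_0_le_iff)
  have Pq: "P (f\<^sub>0 - g n) (f\<^sub>0 - g n) \<le> c + 1" and Qq: "Q (g n) (g n) \<le> c + 1" for n
    using qc[of n] P.nonneg[of "f\<^sub>0 - g n"] Q.nonneg[of "g n"] f0 g P.closed
    by (auto simp: q_def)
  \<comment> \<open>Each of the two descriptions of \<open>u\<close> as a limit yields one bound:
    the one through \<open>P\<close> here, the one through \<open>Q\<close> next. Both are
    Cauchy-Schwarz with a constant uniform in \<open>n\<close>.\<close>
  have uP: "(u f)\<^sup>2 \<le> (c + 1) * P f f" if f: "f \<in> X" for f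
  proof (rule LIMSEQ_le_const2)
    show "(\<lambda>n. (v n f)\<^sup>2) \<longlonglongrightarrow> (u f)\<^sup>2" using vu[OF f] by (rule tendsto_power)
    have "(v n f)\<^sup>2 \<le> (c + 1) * P f f" for n
      using P.Cauchy_Schwarz[of "f\<^sub>0 - g n" f] mult_right_mono[OF Pq[of n] P.nonneg[OF f]]
        f f0 g P.closed unfolding v_def by force
    then show "\<exists>N. \<forall>n\<ge>N. (v n f)\<^sup>2 \<le> (c + 1) * P f f" by blast
  qed
  have uQ: "(u f)\<^sup>2 \<le> (c + 1) * Q f f" if f: "f \<in> X" for f
  proof (rule LIMSEQ_le_const2)
    show "(\<lambda>n. (Q (g n) f)\<^sup>2) \<longlonglongrightarrow> (u f)\<^sup>2" using Qu[OF f] by (rule tendsto_power)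
    have "(Q (g n) f)\<^sup>2 \<le> (c + 1) * Q f f" for n
      using Q.Cauchy_Schwarz[of "g n" f] mult_right_mono[OF Qq[of n] Q.nonneg[OF f]] f g by force
    then show "\<exists>N. \<forall>n\<ge>N. (Q (g n) f)\<^sup>2 \<le> (c + 1) * Q f f" by blast
  qed
  have u_add: "u (f + h) = u f + u h" if "f \<in> X" "h \<in> X" for f h
  proof (rule LIMSEQ_unique[OF vu])
    show "(\<lambda>n. v n (f + h)) \<longlonglongrightarrow> u f + u h"
      using tendsto_add[OF vu vu] that f0 g by (simp add: v_def P.bilinear P.closed)
  qed (use that P.closed in auto)
  have u_scale: "u (r *\<^sub>R f) = r * u f" if "f \<in> X" for r f
  proof (rule LIMSEQ_unique[OF vu])
    show "(\<lambda>n. v n (r *\<^sub>R f)) \<longlonglongrightarrow> r * u f"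
      using tendsto_mult_left[OF vu, of f r] that f0 g by (simp add: v_def P.bilinear P.closed)
  qed (use that P.closed in auto)
  \<comment> \<open>Split \<open>f\<^sub>0\<close> as \<open>(f\<^sub>0 - g n) + g n\<close> in the
    second argument. Once the bracket is shown to vanish in the limit,
    \<open>u f\<^sub>0 = c\<close>, which is nonzero.\<close>
  have vf0: "v n f\<^sub>0 = q (g n) - (Q (g n) (g n) - v n (g n))" for n
    using f0 g by (simp add: v_def q_def P.bilinear P.closed)
  \<comment> \<open>The bracket is the first variation at the moving argument \<open>g n\<close>, so
    pointwise convergence is not enough; \<open>first_order\<close> needs a bound on
    \<open>P + Q\<close> at \<open>g n\<close> that is uniform in \<open>n\<close>.\<close>
  have P_bound: "P (g n) (g n) \<le> 2 * P f\<^sub>0 f\<^sub>0 + 2 * (c + 1)" for n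
  proof -
    have h: "f\<^sub>0 - g n \<in> X" using f0 g P.closed by blast
    have "P (g n) (g n) + P (f\<^sub>0 + (f\<^sub>0 - g n)) (f\<^sub>0 + (f\<^sub>0 - g n)) =
        2 * P f\<^sub>0 f\<^sub>0 + 2 * P (f\<^sub>0 - g n) (f\<^sub>0 - g n)"
      using P.expand[OF f0 h, of 1] P.expand[OF f0 h, of "-1"] by simp
    moreover have "0 \<le> P (f\<^sub>0 + (f\<^sub>0 - g n)) (f\<^sub>0 + (f\<^sub>0 - g n))"
      using f0 h P.closed by (intro P.nonneg) simp
    ultimately show ?thesis using Pq[of n] by simp
  qed
  define M where "M = 2 * P f\<^sub>0 f\<^sub>0 + 3 * (c + 1)"
  have "(\<lambda>n. (Q (g n) (g n) - v n (g n))\<^sup>2) \<longlonglongrightarrow> 0"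
  proof (rule tendsto_sandwich)
    show "(\<lambda>n. 0 :: real) \<longlonglongrightarrow> 0" by simp
    show "(\<lambda>n. (q (g n) - c) * M) \<longlonglongrightarrow> 0"
      using tendsto_mult_left_zero[OF LIM_zero[OF qlim]] .
    have "(Q (g n) (g n) - v n (g n))\<^sup>2 \<le> (q (g n) - c) * M" for n
    proof -
      have "P (g n) (g n) + Q (g n) (g n) \<le> M"
        using P_bound[of n] Qq[of n] by (simp add: M_def)
      then show ?thesis
        using first_order[OF g g, of n n] mult_left_mono[of _ M "q (g n) - c"] c_le[OF g, of n]
        unfolding v_def by fastforce
    qed
    then show "\<forall>\<^sub>F n in sequentially. (Q (g n) (g n) - v n (g n))\<^sup>2 \<le> (q (g n) - c) * M"
      by simp
  qed auto
  then have "(\<lambda>n. Q (g n) (g n) - v n (g n)) \<longlonglongrightarrow> 0" by simp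
  then have "(\<lambda>n. v n f\<^sub>0) \<longlonglongrightarrow> c"
    unfolding vf0 using tendsto_diff[OF qlim] by force
  then have "u f\<^sub>0 = c" using vu[OF f0] LIMSEQ_unique by blast
  then have "u f\<^sub>0 \<noteq> 0" using c by simp
  show ?thesis
    by (rule that[OF u_add u_scale _ uP uQ f0 \<open>u f\<^sub>0 \<noteq> 0\<close>]) (use c in auto)
qed

text \<open>Split \<open>f\<close> as \<open>h + g\<close> with \<open>P h h\<close> and
  \<open>Q g g\<close> small. On \<open>h\<close> the bound by \<open>P + Q\<close> is used, where
  \<open>Q h h\<close> is close to \<open>Q f f\<close>; on \<open>g\<close> the bound by
  \<open>2 * Q\<close>, whose factor only affects a vanishing term.\<close>

lemma le_if_singular:
  assumes sing: singular
    and "psd_form X R"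
    and le1: "\<And>f. f \<in> X \<Longrightarrow> R f f \<le> 2 * Q f f"
    and le2: "\<And>f. f \<in> X \<Longrightarrow> R f f \<le> P f f + Q f f"
    and f: "f \<in> X"
  shows "R f f \<le> Q f f"
proof -
  interpret R: psd_form X R by fact
  have "sqrt (R f f) \<le> sqrt (Q f f)"
  proof (rule field_le_epsilon)
    fix e :: real assume e: "0 < e"
    \<comment> \<open>The error \<open>e\<close> is spent as follows: a quarter on
      \<open>P h h\<close>, a quarter on passing from \<open>Q h h\<close> to \<open>Q f f\<close>,
      and half on \<open>R g g\<close>.\<close>
    then obtain g where g: "g \<in> X" and small: "P (f - g) (f - g) + Q g g < (e / 4)\<^sup>2"
      using sing f unfolding singular_def by (meson divide_pos_pos zero_less_numeral zero_less_power)
    define h where "h = f - g"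
    have h: "h \<in> X" unfolding h_def using f g P.closed by blast
    have fh: "f = h + g" and hf: "h = f + (-1) *\<^sub>R g" by (auto simp: h_def)
    have "P h h < (e / 4)\<^sup>2" "Q g g < (e / 4)\<^sup>2"
      using small P.nonneg[OF h] Q.nonneg[OF g] by (auto simp: h_def)
    then have Ph: "sqrt (P h h) \<le> e / 4" and Qg: "sqrt (Q g g) \<le> e / 4"
      using e by (intro real_le_lsqrt; simp)+
    have "sqrt (R h h) \<le> sqrt (P h h + Q h h)"
      using le2[OF h] by simp
    also have "\<dots> \<le> sqrt (P h h) + sqrt (Q h h)"
      by (intro sqrt_add_le_add_sqrt P.nonneg Q.nonneg h)
    also have "sqrt (Q h h) \<le> sqrt (Q f f) + sqrt (Q g g)"
      using Q.triangle[OF f P.closed(2)[OF g, of "-1"]] g P.closed(2)[OF g, of "-1"]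
      by (simp add: Q.scale_left Q.scale_right hf del: scaleR_minus_left scaleR_minus1_left)
    finally have Rh: "sqrt (R h h) \<le> e / 4 + (sqrt (Q f f) + e / 4)"
      using Ph Qg by simp
    have "sqrt (R g g) \<le> sqrt (2 * Q g g)"
      using le1[OF g] by simp
    also have "\<dots> \<le> sqrt (Q g g) + sqrt (Q g g)"
      using sqrt_add_le_add_sqrt[OF Q.nonneg[OF g] Q.nonneg[OF g]] by simp
    finally have "sqrt (R g g) \<le> e / 2" using Qg by simp
    moreover have "sqrt (R f f) \<le> sqrt (R h h) + sqrt (R g g)"
      using R.triangle[OF h g] by (simp flip: fh)
    ultimately show "sqrt (R f f) \<le> sqrt (Q f f) + e" using Rh by simp
  qed
  then show ?thesis by simp
qed

end

section \<open>Kernels and their forms\<close>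

text \<open>The algebraic half of \<open>is_kernel\<close>. Unlike positivity it survives
  differences, such as the perturbations of an extreme point.\<close>

definition dual_valued :: "('s, 'a::complex_banach) operator_kernel \<Rightarrow> bool"
  where "dual_valued K \<longleftrightarrow> (\<forall>s t. K s t \<in> operators_to_dual)"

lemma is_kernel_iff:
  "is_kernel K \<longleftrightarrow> dual_valued K \<and> (\<forall>f\<in>finitely_supported. 0 \<le> kernel_sum K f)"
  by (simp add: is_kernel_def dual_valued_def)

lemma operators_to_dual_iff:
  "T \<in> operators_to_dual \<longleftrightarrow>
    (\<forall>c x y. T x (c *\<^sub>C y) = c * T x y) \<and> (\<forall>c x y. T (c *\<^sub>C x) y = cnj c * T x y)"
  by (auto simp: operators_to_dual_def topological_dual_def scaleC_dual_def fun_eq_iff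
      simp flip: blinfun_apply_inject)

lemma subspace_operators_to_dual: "subspace operators_to_dual"
  by (auto simp: subspace_def operators_to_dual_iff blinfun.bilinear_simps algebra_simps)

lemma dual_valued_add: "dual_valued K \<Longrightarrow> dual_valued L \<Longrightarrow> dual_valued (K + L)"
  and dual_valued_diff: "dual_valued K \<Longrightarrow> dual_valued L \<Longrightarrow> dual_valued (K - L)"
  and dual_valued_scaleR: "dual_valued K \<Longrightarrow> dual_valued (r *\<^sub>R K)"
  and dual_valued_0: "dual_valued 0"
  using subspace_operators_to_dual
  by (auto simp: dual_valued_def fun_diff_def
      intro: subspace_add subspace_diff subspace_scale subspace_0)

lemmas dual_valued_intros =
  dual_valued_add dual_valued_diff dual_valued_scaleR dual_valued_0

definition kernel_form ::
    "('s, 'a::complex_banach) operator_kernel \<Rightarrow> ('s \<Rightarrow> 'a) \<Rightarrow> ('s \<Rightarrow> 'a) \<Rightarrow> complex"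
  where "kernel_form K f g = (\<Sum>s | f s \<noteq> 0. \<Sum>t | g t \<noteq> 0. K s t (f s) (g t))"

lemma kernel_sum_conv_form: "kernel_sum K f = kernel_form K f f"
  by (simp add: kernel_sum_def kernel_form_def dual_pairing_def)

text \<open>The index sets in \<open>kernel_form\<close> depend on the arguments; common finite
  supersets allow forms at different arguments to be compared termwise.\<close>

lemma kernel_form_eq:
  assumes "finite A" "finite B" "{s. f s \<noteq> 0} \<subseteq> A" "{t. g t \<noteq> 0} \<subseteq> B"
  shows "kernel_form K f g = (\<Sum>s\<in>A. \<Sum>t\<in>B. K s t (f s) (g t))"
proof -
  have "(\<Sum>t | g t \<noteq> 0. K s t (f s) (g t)) = (\<Sum>t\<in>B. K s t (f s) (g t))" for s
    using assms by (intro sum.mono_neutral_left) (auto simp: blinfun.bilinear_simps)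
  then show ?thesis
    unfolding kernel_form_def using assms
    by (simp, intro sum.mono_neutral_left) (auto simp: blinfun.bilinear_simps)
qed

lemma subspace_finitely_supported:
  "subspace (finitely_supported :: ('s \<Rightarrow> 'a::complex_banach) set)"
proof (rule subspaceI)
  fix f g :: "'s \<Rightarrow> 'a" and r :: real
  assume f: "f \<in> finitely_supported"
  have "finite {s. (r *\<^sub>R f) s \<noteq> 0}"
    by (rule finite_subset[of _ "{s. f s \<noteq> 0}"]) (use f in \<open>auto simp: finitely_supported_def\<close>)
  then show "r *\<^sub>R f \<in> finitely_supported" by (simp add: finitely_supported_def)
  assume g: "g \<in> finitely_supported"
  have "finite {s. (f + g) s \<noteq> 0}"
    by (rule finite_subset[of _ "{s. f s \<noteq> 0} \<union> {s. g s \<noteq> 0}"])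
      (use f g in \<open>auto simp: finitely_supported_def\<close>)
  then show "f + g \<in> finitely_supported" by (simp add: finitely_supported_def)
qed (simp add: finitely_supported_def)

lemma kernel_form_add_left:
  assumes "f \<in> finitely_supported" "g \<in> finitely_supported" "h \<in> finitely_supported"
  shows "kernel_form K (f + g) h = kernel_form K f h + kernel_form K g h"
proof -
  let ?A = "{s. f s \<noteq> 0} \<union> {s. g s \<noteq> 0}" and ?B = "{t. h t \<noteq> 0}"
  have "finite ?A" "finite ?B" using assms by (auto simp: finitely_supported_def)
  note eq = kernel_form_eq[OF this]
  show ?thesis
    by (subst (1 2 3) eq) (auto simp: blinfun.bilinear_simps sum.distrib)
qed

lemma kernel_form_add_right:
  assumes "f \<in> finitely_supported" "g \<in> finitely_supported" "h \<in> finitely_supported"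
  shows "kernel_form K h (f + g) = kernel_form K h f + kernel_form K h g"
proof -
  let ?A = "{s. f s \<noteq> 0} \<union> {s. g s \<noteq> 0}" and ?B = "{t. h t \<noteq> 0}"
  have "finite ?B" "finite ?A" using assms by (auto simp: finitely_supported_def)
  note eq = kernel_form_eq[OF this]
  show ?thesis
    by (subst (1 2 3) eq) (auto simp: blinfun.bilinear_simps sum.distrib)
qed

lemma kernel_form_scaleR:
  "kernel_form K (r *\<^sub>R f) h = r *\<^sub>R kernel_form K f h"
  "kernel_form K h (r *\<^sub>R f) = r *\<^sub>R kernel_form K h f"
  by (cases "r = 0"; simp add: kernel_form_def blinfun.bilinear_simps scaleR_sum_right)+

lemma kernel_sum_add: "kernel_sum (K + L) f = kernel_sum K f + kernel_sum L f"
  and kernel_sum_diff: "kernel_sum (K - L) f = kernel_sum K f - kernel_sum L f"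
  and kernel_sum_scaleR: "kernel_sum (r *\<^sub>R K) f = r *\<^sub>R kernel_sum K f"
  and kernel_sum_0: "kernel_sum 0 f = 0"
  by (simp_all add: kernel_sum_def dual_pairing_def fun_diff_def blinfun.bilinear_simps
      sum.distrib sum_subtractf scaleR_sum_right)

lemmas kernel_sum_linear = kernel_sum_add kernel_sum_diff kernel_sum_scaleR kernel_sum_0

text \<open>Symmetrising spares the proof that positive kernels have Hermitian forms.\<close>

definition real_form ::
    "('s, 'a::complex_banach) operator_kernel \<Rightarrow> ('s \<Rightarrow> 'a) \<Rightarrow> ('s \<Rightarrow> 'a) \<Rightarrow> real"
  where "real_form K f g = (Re (kernel_form K f g) + Re (kernel_form K g f)) / 2"

lemma real_form_same: "real_form K f f = Re (kernel_sum K f)"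
  by (simp add: real_form_def kernel_sum_conv_form)

lemma psd_form_real_form:
  assumes "is_kernel K"
  shows "psd_form finitely_supported (real_form K)"
proof
  show "0 \<le> real_form K f f" if "f \<in> finitely_supported" for f
    using assms that by (simp add: real_form_same is_kernel_iff less_eq_complex_def)
qed (auto simp: subspace_finitely_supported real_form_def kernel_form_add_left
    kernel_form_add_right kernel_form_scaleR field_simps)

section \<open>The cone of kernels and its order intervals\<close>

lemma is_kernel_add: "is_kernel K \<Longrightarrow> is_kernel L \<Longrightarrow> is_kernel (K + L)"
  by (simp add: is_kernel_iff dual_valued_intros kernel_sum_linear)

lemma is_kernel_scaleR: "is_kernel K \<Longrightarrow> 0 \<le> r \<Longrightarrow> is_kernel (r *\<^sub>R K)"
  by (simp add: is_kernel_iff dual_valued_intros kernel_sum_linear less_eq_complex_def)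

lemma is_kernel_0: "is_kernel 0"
  by (simp add: is_kernel_iff dual_valued_intros kernel_sum_linear)

lemma is_kernel_diff_iff:
  assumes "is_kernel K" "is_kernel L"
  shows "is_kernel (L - K) \<longleftrightarrow> K \<preceq>\<^sub>K L"
  using assms by (simp add: is_kernel_iff dual_valued_intros kernel_sum_linear kernel_le_def)

text \<open>Positivity makes both kernel sums real, so comparing real parts loses nothing.\<close>

lemma is_kernel_diff_iff_real_form:
  assumes "is_kernel K" "is_kernel L"
  shows "is_kernel (L - K) \<longleftrightarrow> (\<forall>f\<in>finitely_supported. real_form K f f \<le> real_form L f f)"
  using assms unfolding is_kernel_diff_iff[OF assms]
  by (auto simp: is_kernel_iff kernel_le_def real_form_same less_eq_complex_def)

lemma mem_kernel_interval_iff: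
  assumes "is_kernel K\<^sub>1" "is_kernel K\<^sub>2"
  shows "U \<in> kernel_interval K\<^sub>1 K\<^sub>2 \<longleftrightarrow>
    is_kernel U \<and> is_kernel (U - K\<^sub>1) \<and> is_kernel (K\<^sub>2 - U)"
  using assms by (auto simp: kernel_interval_def is_kernel_diff_iff)

lemma convex_kernel_interval:
  assumes "is_kernel K\<^sub>1" "is_kernel K\<^sub>2"
  shows "convex (kernel_interval K\<^sub>1 K\<^sub>2)"
  unfolding convex_alt
proof (intro ballI allI impI)
  fix U V and u :: real
  assume U: "U \<in> kernel_interval K\<^sub>1 K\<^sub>2" and V: "V \<in> kernel_interval K\<^sub>1 K\<^sub>2"
    and u: "0 \<le> u \<and> u \<le> 1"
  have eq: "(1 - u) *\<^sub>R U + u *\<^sub>R V - K\<^sub>1 = (1 - u) *\<^sub>R (U - K\<^sub>1) + u *\<^sub>R (V - K\<^sub>1)"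
    "K\<^sub>2 - ((1 - u) *\<^sub>R U + u *\<^sub>R V) = (1 - u) *\<^sub>R (K\<^sub>2 - U) + u *\<^sub>R (K\<^sub>2 - V)"
    by (simp_all add: algebra_simps)
  show "(1 - u) *\<^sub>R U + u *\<^sub>R V \<in> kernel_interval K\<^sub>1 K\<^sub>2"
    using U V u unfolding mem_kernel_interval_iff[OF assms] eq
    by (auto intro!: is_kernel_add is_kernel_scaleR)
qed

section \<open>One-point functions and polarisation\<close>

definition single :: "'s \<Rightarrow> 'a::zero \<Rightarrow> 's \<Rightarrow> 'a"
  where "single s x = (\<lambda>r. if r = s then x else 0)"

lemma single_finitely_supported [simp]: "single s x \<in> finitely_supported"
  by (simp add: finitely_supported_def single_def)

lemma kernel_form_single: "kernel_form K (single s x) (single t y) = K s t x y"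
  by (subst kernel_form_eq[of "{s}" "{t}"]) (auto simp: single_def split: if_splits)

lemma eq_0_if_kernel_sum_eq_0:
  assumes "dual_valued D" and "\<And>f. f \<in> finitely_supported \<Longrightarrow> kernel_sum D f = 0"
  shows "D = 0"
proof -
  have polar: "D s t x y + D t s y x = 0" for s t x y
  proof -
    have "kernel_sum D (single s x + single t y) = kernel_sum D (single s x) +
        kernel_form D (single s x) (single t y) + kernel_form D (single t y) (single s x) +
        kernel_sum D (single t y)"
      by (simp add: kernel_sum_conv_form kernel_form_add_left kernel_form_add_right
          subspace_add[OF subspace_finitely_supported])
    then show ?thesis
      by (simp add: assms(2) subspace_add[OF subspace_finitely_supported] kernel_form_single)
  qed
  have "D s t x y = 0" for s t x y
    \<comment> \<open>Replacing \<open>x\<close> by \<open>\<i> *\<^sub>C x\<close> multiplies the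
      first term by \<open>- \<i>\<close> and the second by \<open>\<i>\<close>; so the two terms
      are equal as well as opposite.\<close>
    using polar[of s t x y] polar[of s t "\<i> *\<^sub>C x" y] assms(1)
    by (auto simp: dual_valued_def operators_to_dual_iff add_eq_0_iff)
  then show ?thesis by (intro ext blinfun_eqI) simp
qed

section \<open>Rank-one kernels and multiplication by the imaginary unit\<close>

definition rank_one :: "('s \<Rightarrow> 'a::complex_banach \<Rightarrow>\<^sub>L complex) \<Rightarrow> ('s, 'a) operator_kernel"
  where "rank_one \<psi> s t = Blinfun (\<lambda>x. scaleC_dual (\<psi> s x) (\<psi> t))"

lemma rank_one_apply: "rank_one \<psi> s t x y = cnj (\<psi> s x) * \<psi> t y"
proof -
  have "bounded_linear (\<lambda>x. scaleC_dual (\<psi> s x) (\<psi> t))"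
    unfolding scaleC_dual_def
    by (intro bounded_bilinear.bounded_linear_left bounded_bilinear_blinfun_compose
        bounded_linear_compose[OF bounded_bilinear.bounded_linear_left[OF bounded_bilinear_blinfun_compose]]
        bounded_linear_compose[OF bounded_linear_blinfun_mult_right]
        bounded_linear_compose[OF bounded_linear_cnj] blinfun.bounded_linear_right)
  then show ?thesis
    by (simp add: rank_one_def bounded_linear_Blinfun_apply scaleC_dual_def)
qed

text \<open>The double sum factors as \<open>cnj z * z\<close>, where \<open>z\<close> is the sum of
  the \<open>\<psi> s (f s)\<close>.\<close>

lemma kernel_sum_rank_one:
  "kernel_sum (rank_one \<psi>) f = complex_of_real ((cmod (\<Sum>s | f s \<noteq> 0. \<psi> s (f s)))\<^sup>2)"
  unfolding complex_norm_square cnj_sum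
  by (subst mult.commute)
    (simp add: kernel_sum_conv_form kernel_form_def rank_one_apply sum_product)

lemma is_kernel_rank_one:
  assumes "\<And>s. \<psi> s \<in> topological_dual"
  shows "is_kernel (rank_one \<psi>)"
  using assms
  by (auto simp: is_kernel_iff dual_valued_def operators_to_dual_iff rank_one_apply
      topological_dual_def kernel_sum_rank_one less_eq_complex_def)

text \<open>Multiplication by \<open>\<i>\<close> preserves supports, and the factors
  \<open>cnj \<i>\<close> and \<open>\<i>\<close> cancel. This carries bounds on a real functional
  over to its complexification.\<close>

lemma real_form_scale_ii:
  fixes K :: "('s, 'b::complex_banach) operator_kernel"
  assumes "dual_valued K"
  shows "real_form K (\<lambda>s. \<i> *\<^sub>C f s) (\<lambda>s. \<i> *\<^sub>C f s) = real_form K f f"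
proof -
  have "\<i> *\<^sub>C x = 0 \<longleftrightarrow> x = 0" for x :: 'b
    using norm_scaleC[of \<i> x] by (metis mult_1 norm_eq_zero norm_ii)
  then have "kernel_sum K (\<lambda>s. \<i> *\<^sub>C f s) = kernel_sum K f"
    using assms
    by (simp add: kernel_sum_conv_form kernel_form_def dual_valued_def operators_to_dual_iff)
  then show ?thesis by (simp add: real_form_same)
qed

text \<open>Reduces complex linearity to real linearity and compatibility with
  \<open>\<i>\<close>.\<close>

lemma scaleC_Complex: "Complex a b *\<^sub>C x = a *\<^sub>R x + b *\<^sub>R (\<i> *\<^sub>C x)"
proof -
  have "Complex a b *\<^sub>C x = (complex_of_real a + complex_of_real b * \<i>) *\<^sub>C x"
    by (simp add: Complex_eq mult.commute)
  also have "\<dots> = a *\<^sub>R x + b *\<^sub>R (\<i> *\<^sub>C x)"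
    by (simp only: scaleC_add_left scaleC_of_real flip: scaleC_scaleC)
  finally show ?thesis .
qed

section \<open>Extreme points of kernel intervals\<close>

lemma psd_form_pair_real_form:
  assumes "is_kernel K" "is_kernel L"
  shows "psd_form_pair finitely_supported (real_form K) (real_form L)"
  using assms by (simp add: psd_form_pair_def psd_form_real_form)

lemma sum_single:
  assumes "f \<in> finitely_supported"
  shows "(\<Sum>s | f s \<noteq> 0. single s (f s)) = (f :: 's \<Rightarrow> 'a::complex_banach)"
proof
  fix r
  have apply_sum: "(\<Sum>s\<in>A. h s) r = (\<Sum>s\<in>A. h s r)" if "finite A" for A :: "'s set" and h :: "'s \<Rightarrow> 's \<Rightarrow> 'a"
    using that by induction auto
  have "finite {s. f s \<noteq> 0}" using assms by (simp add: finitely_supported_def)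
  then show "(\<Sum>s | f s \<noteq> 0. single s (f s)) r = f r"
    by (simp add: apply_sum single_def sum.delta if_distrib cong: if_cong)
qed

text \<open>Provides continuity: a functional dominated by the form of \<open>K\<close> is bounded
  on functions supported at a single point.\<close>

lemma real_form_single_le:
  "real_form K (single s x) (single s x) \<le> norm (K s s) * (norm x)\<^sup>2"
proof -
  have "real_form K (single s x) (single s x) = Re (K s s x x)"
    by (simp add: real_form_same kernel_sum_conv_form kernel_form_single)
  also have "\<dots> \<le> norm (K s s x x)" by (rule complex_Re_le_cmod)
  also have "\<dots> \<le> norm (K s s x) * norm x" by (rule norm_blinfun)
  also have "\<dots> \<le> norm (K s s) * norm x * norm x"
    by (intro mult_right_mono norm_blinfun) simp
  finally show ?thesis by (simp add: power2_eq_square)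
qed

text \<open>
  If \<open>K\<close> and \<open>L\<close> had a common nonzero minorant, there would be one of rank one, say \<open>D\<close>, and
  \<open>K\<close> would be the midpoint of \<open>K + D\<close> and \<open>K - D\<close>.
\<close>

lemma singular_if_extreme:
  fixes K L :: "('s, 'a::complex_banach) operator_kernel"
  assumes K: "is_kernel K" and L: "is_kernel L"
    and extreme: "K extreme_point_of kernel_interval 0 (K + L)"
  shows "psd_form_pair.singular finitely_supported (real_form K) (real_form L)"
proof (rule ccontr)
  interpret psd_form_pair finitely_supported "real_form K" "real_form L"
    using K L by (rule psd_form_pair_real_form)
  note X = subspace_finitely_supported
  assume "\<not> singular"
  then obtain u C f\<^sub>0 where
    u_add: "\<And>f g. f \<in> finitely_supported \<Longrightarrow> g \<in> finitely_supported \<Longrightarrow> u (f + g) = u f + u g" and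
    u_scale: "\<And>r f. f \<in> finitely_supported \<Longrightarrow> u (r *\<^sub>R f) = r * u f" and
    C: "0 < C" and
    uK: "\<And>f. f \<in> finitely_supported \<Longrightarrow> (u f)\<^sup>2 \<le> C * real_form K f f" and
    uL: "\<And>f. f \<in> finitely_supported \<Longrightarrow> (u f)\<^sup>2 \<le> C * real_form L f f" and
    f0: "f\<^sub>0 \<in> finitely_supported" "u f\<^sub>0 \<noteq> 0"
    by (rule common_minorant_if_not_singular) blast
  define I where "I f = (\<lambda>s. \<i> *\<^sub>C f s)" for f :: "'s \<Rightarrow> 'a"
  have scaleC_0 [simp]: "c *\<^sub>C (0::'a) = 0" for c
    using scaleC_add_right[of c 0 "0::'a"] by simp
  have I_X: "I f \<in> finitely_supported" if "f \<in> finitely_supported" for f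
    unfolding finitely_supported_def
    using that by (auto simp: I_def finitely_supported_def elim!: rev_finite_subset)
  have I_single: "I (single s x) = single s (\<i> *\<^sub>C x)" for s x
    by (auto simp: I_def single_def)
  have I_form: "real_form M (I f) (I f) = real_form M f f" if "is_kernel M" for M f
    using that real_form_scale_ii by (auto simp: I_def is_kernel_iff)
  have II: "I (I f) = (-1) *\<^sub>R f" for f
    using scaleC_of_real[of "-1" "f _"] by (simp add: fun_eq_iff I_def scaleC_scaleC)
  have I_add: "I (f + g) = I f + I g" for f g
    by (auto simp: I_def scaleC_add_right)
  have I_scale: "I (r *\<^sub>R f) = r *\<^sub>R I f" for r f
    by (auto simp: I_def scaleC_scaleC mult.commute simp flip: scaleC_of_real)
  \<comment> \<open>The complex-linear functional with real part \<open>u\<close>.\<close>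
  define \<phi> where "\<phi> f = Complex (u f) (- u (I f))" for f
  have \<phi>_add: "\<phi> (f + g) = \<phi> f + \<phi> g" if "f \<in> finitely_supported" "g \<in> finitely_supported" for f g
    using that by (simp add: \<phi>_def I_add u_add I_X complex_eq_iff)
  have \<phi>_scale: "\<phi> (r *\<^sub>R f) = r *\<^sub>R \<phi> f" if "f \<in> finitely_supported" for r f
    using that by (simp add: \<phi>_def I_scale u_scale I_X complex_eq_iff)
  have \<phi>_I: "\<phi> (I f) = \<i> * \<phi> f" if "f \<in> finitely_supported" for f
    using that by (simp add: \<phi>_def II u_scale complex_eq_iff del: scaleR_minus_left scaleR_minus1_left)
  have \<phi>_sum: "\<phi> (\<Sum>s\<in>A. h s) = (\<Sum>s\<in>A. \<phi> (h s))"
    if "finite A" "\<And>s. h s \<in> finitely_supported" for A and h :: "'s \<Rightarrow> 's \<Rightarrow> 'a"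
    using that(1)
  proof induction
    case empty
    show ?case using \<phi>_scale[OF subspace_0[OF X], of 0] by (simp add: zero_fun_def)
  next
    case (insert r A)
    then show ?case
      by (simp only: sum.insert \<phi>_add that(2) subspace_sum[OF X] simp_thms)
  qed
  \<comment> \<open>The squared modulus is the sum of the squares of \<open>u\<close> at
    \<open>f\<close> and at \<open>I f\<close>, and the form of \<open>M\<close> agrees at these two
    points.\<close>
  have \<phi>_bound: "(cmod (\<phi> f))\<^sup>2 \<le> 2 * C * real_form M f f"
    if "f \<in> finitely_supported" "is_kernel M"
      "\<And>f. f \<in> finitely_supported \<Longrightarrow> (u f)\<^sup>2 \<le> C * real_form M f f" for f M
    using that(3)[OF that(1)] that(3)[OF I_X[OF that(1)]] I_form[OF that(2)]
    by (simp add: \<phi>_def cmod_def)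
  have single_add: "single s (x + y) = single s x + single s y" for s and x y :: 'a
    by (auto simp: single_def)
  have single_scale: "single s (r *\<^sub>R x) = r *\<^sub>R single s x" for s r and x :: 'a
    by (auto simp: single_def)
  define \<psi> where "\<psi> s = Blinfun (\<lambda>x. \<phi> (single s x))" for s
  have \<psi>: "\<psi> s x = \<phi> (single s x)" for s x
  proof -
    have "bounded_linear (\<lambda>x. \<phi> (single s x))"
    proof (rule bounded_linear_intro)
      fix x
      have "(cmod (\<phi> (single s x)))\<^sup>2 \<le> 2 * C * real_form K (single s x) (single s x)"
        by (rule \<phi>_bound) (use K uK in auto)
      also have "\<dots> \<le> 2 * C * (norm (K s s) * (norm x)\<^sup>2)"
        using C by (intro mult_left_mono real_form_single_le) simp
      finally have "cmod (\<phi> (single s x)) \<le> sqrt (2 * C * (norm (K s s) * (norm x)\<^sup>2))"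
        by (rule real_le_rsqrt)
      then show "norm (\<phi> (single s x)) \<le> norm x * sqrt (2 * C * norm (K s s))"
        by (simp add: real_sqrt_mult mult_ac)
    qed (simp_all add: single_add single_scale \<phi>_add \<phi>_scale)
    then show ?thesis by (simp add: \<psi>_def bounded_linear_Blinfun_apply)
  qed
  have \<psi>_dual: "\<psi> s \<in> topological_dual" for s
  proof -
    have ii: "\<psi> s (\<i> *\<^sub>C x) = \<i> * \<psi> s x" for x
      using \<phi>_I[of "single s x"] by (simp add: \<psi> I_single)
    have "\<psi> s (Complex a b *\<^sub>C x) = a *\<^sub>R \<psi> s x + b *\<^sub>R (\<i> * \<psi> s x)" for a b x
      by (simp only: scaleC_Complex blinfun.add_right blinfun.scaleR_right ii)
    then have Complex: "\<psi> s (Complex a b *\<^sub>C x) = Complex a b * \<psi> s x" for a b x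
      by (simp only:) (simp add: complex_eq_iff)
    have "\<psi> s (c *\<^sub>C x) = c * \<psi> s x" for c x
      using Complex[of "Re c" "Im c" x] by (simp only: complex_surj)
    then show ?thesis by (simp add: topological_dual_def)
  qed
  \<comment> \<open>The factor turns \<open>\<phi>_bound\<close> into domination of \<open>D\<close>
    by both \<open>K\<close> and \<open>L\<close>.\<close>
  define D where "D = (1 / (2 * C)) *\<^sub>R rank_one \<psi>"
  have D: "is_kernel D"
    unfolding D_def using C \<psi>_dual by (intro is_kernel_scaleR is_kernel_rank_one) auto
  have D_form: "real_form D f f = (cmod (\<phi> f))\<^sup>2 / (2 * C)" if "f \<in> finitely_supported" for f
  proof -
    have "finite {s. f s \<noteq> 0}" using that by (simp add: finitely_supported_def)
    then have "(\<Sum>s | f s \<noteq> 0. \<psi> s (f s)) = \<phi> f"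
      using \<phi>_sum[of "{s. f s \<noteq> 0}" "\<lambda>s. single s (f s)"] by (simp add: \<psi> sum_single[OF that])
    then show ?thesis
      by (simp add: real_form_same D_def kernel_sum_linear kernel_sum_rank_one)
  qed
  have minorant: "is_kernel (M - D)" if M: "is_kernel M"
      "\<And>f. f \<in> finitely_supported \<Longrightarrow> (u f)\<^sup>2 \<le> C * real_form M f f" for M
    unfolding is_kernel_diff_iff_real_form[OF D M(1)]
    using C \<phi>_bound[OF _ M] by (auto simp: D_form field_simps)
  \<comment> \<open>\<open>K + D\<close> stays below \<open>K + L\<close> because \<open>D\<close>
    is below \<open>L\<close>; \<open>K - D\<close> stays above 0 because \<open>D\<close> is below
    \<open>K\<close>.\<close>
  have "K - D - 0 = K - D" "K + L - (K + D) = L - D" "K + L - (K - D) = L + D" by auto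
  then have "K + D \<in> kernel_interval 0 (K + L)" "K - D \<in> kernel_interval 0 (K + L)"
    using minorant[OF K uK] minorant[OF L uL] K L D
    by (simp_all add: mem_kernel_interval_iff is_kernel_0 is_kernel_add)
  then have "D = 0"
    by (rule extreme_point_of_symmetric[OF extreme])
  then have "\<phi> f\<^sub>0 = 0"
    using D_form[OF f0(1)] C by (simp add: real_form_same kernel_sum_linear)
  then show False using f0 by (simp add: \<phi>_def complex_eq_iff)
qed

text \<open>A symmetric perturbation \<open>D\<close> of the least element has both \<open>D\<close>
  and \<open>- D\<close> in the cone of kernels, so its form vanishes and polarisation gives
  \<open>D = 0\<close>.\<close>

lemma minimum_extreme_point_of_kernel_interval:
  assumes K: "is_kernel K" and L: "is_kernel L"
  shows "K extreme_point_of kernel_interval K (K + L)"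
proof (rule extreme_point_ofI_symmetric)
  have KL: "is_kernel (K + L)" using K L by (rule is_kernel_add)
  show "convex (kernel_interval K (K + L))"
    using K KL by (rule convex_kernel_interval)
  show "K \<in> kernel_interval K (K + L)"
    using K L KL by (simp add: mem_kernel_interval_iff is_kernel_0)
  fix D assume "K + D \<in> kernel_interval K (K + L)" "K - D \<in> kernel_interval K (K + L)"
  then have "is_kernel D" "is_kernel (0 - D)"
    by (simp_all add: mem_kernel_interval_iff K KL)
  then show "D = 0"
    by (intro eq_0_if_kernel_sum_eq_0)
      (auto simp: is_kernel_iff is_kernel_diff_iff kernel_sum_linear
        simp del: diff_0 intro: antisym)
qed

section \<open>From singularity to extreme points of the larger interval\<close>

lemma is_kernel_diff_if_singular:
  assumes K: "is_kernel K" and L: "is_kernel L" and R: "is_kernel R"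
    and sing: "psd_form_pair.singular finitely_supported (real_form K) (real_form L)"
    and le1: "is_kernel (2 *\<^sub>R L - R)" and le2: "is_kernel (K + L - R)"
  shows "is_kernel (L - R)"
  unfolding is_kernel_diff_iff_real_form[OF R L]
proof
  interpret psd_form_pair finitely_supported "real_form K" "real_form L"
    using K L by (rule psd_form_pair_real_form)
  fix f :: "'a \<Rightarrow> 'b" assume f: "f \<in> finitely_supported"
  have L2: "is_kernel (2 *\<^sub>R L)" using L by (simp add: is_kernel_scaleR)
  show "real_form R f f \<le> real_form L f f"
  proof (rule le_if_singular[OF sing psd_form_real_form[OF R] _ _ f])
    fix g :: "'a \<Rightarrow> 'b" assume g: "g \<in> finitely_supported"
    show "real_form R g g \<le> 2 * real_form L g g"
      using le1 g unfolding is_kernel_diff_iff_real_form[OF R L2]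
      by (auto simp: real_form_same kernel_sum_linear)
    show "real_form R g g \<le> real_form K g g + real_form L g g"
      using le2 g unfolding is_kernel_diff_iff_real_form[OF R is_kernel_add[OF K L]]
      by (auto simp: real_form_same kernel_sum_linear)
  qed
qed

lemma extreme_point_of_larger_interval:
  assumes K: "is_kernel K" and L: "is_kernel L"
    and K_ext: "K extreme_point_of kernel_interval 0 (K + L)"
    and U_ext: "U extreme_point_of kernel_interval K (K + L)"
  shows "U extreme_point_of kernel_interval 0 (K + L)"
proof (rule extreme_point_ofI_symmetric)
  note KL = is_kernel_add[OF K L]
  have U: "is_kernel U" "is_kernel (U - K)" "is_kernel (K + L - U)"
    using U_ext by (auto simp: extreme_point_of_def mem_kernel_interval_iff K KL)
  show "convex (kernel_interval 0 (K + L))"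
    by (rule convex_kernel_interval[OF is_kernel_0 KL])
  show "U \<in> kernel_interval 0 (K + L)"
    using U by (simp add: mem_kernel_interval_iff is_kernel_0 KL)
  \<comment> \<open>The hypotheses are met by \<open>- D\<close> as well as by \<open>D\<close>, so
    both perturbations land in the smaller interval, where \<open>U\<close> is extreme.\<close>
  have step: "U + D \<in> kernel_interval K (K + L)"
    if "is_kernel (U + D)" "is_kernel (K + L - (U + D))" "is_kernel (K + L - (U - D))" for D
  proof -
    define R where "R = K + L - (U + D)"
    have R: "is_kernel R" using that by (simp add: R_def)
    \<comment> \<open>Both summands are kernels: \<open>U - D\<close> lies below
      \<open>K + L\<close>, and \<open>U\<close> lies above \<open>K\<close>.\<close>
    have "2 *\<^sub>R L - R = (K + L - (U - D)) + 2 *\<^sub>R (U - K)"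
      by (simp add: R_def algebra_simps scaleR_2)
    then have le1: "is_kernel (2 *\<^sub>R L - R)"
      using that U by (simp only: is_kernel_add is_kernel_scaleR)
    have le2: "is_kernel (K + L - R)" using that by (simp add: R_def add.commute[of D])
    have "is_kernel (L - R)"
      using singular_if_extreme[OF K L K_ext] le1 le2 by (rule is_kernel_diff_if_singular[OF K L R])
    \<comment> \<open>So \<open>R\<close> being below \<open>L\<close> says exactly that
      \<open>U + D\<close> is above \<open>K\<close>.\<close>
    moreover have "L - R = U + D - K" by (simp add: R_def algebra_simps)
    ultimately show ?thesis
      using that by (simp add: mem_kernel_interval_iff K KL)
  qed
  fix D assume "U + D \<in> kernel_interval 0 (K + L)" "U - D \<in> kernel_interval 0 (K + L)"
  then show "D = 0"
    using step[of D] step[of "- D"] extreme_point_of_symmetric[OF U_ext, of D]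
    by (simp add: mem_kernel_interval_iff is_kernel_0 KL)
qed

lemma extreme_iff_ex_kernel_interval_subset:
  assumes "is_kernel K" and "is_kernel L"
  shows "K extreme_point_of kernel_interval 0 (K + L) \<longleftrightarrow>
    ex_kernel_interval K (K + L) \<subseteq> ex_kernel_interval 0 (K + L)"
  using assms minimum_extreme_point_of_kernel_interval extreme_point_of_larger_interval
  unfolding ex_kernel_interval_def by blast

theorem corollary2p9:
  fixes K L :: "('s, 'a::complex_banach) operator_kernel"
  assumes "is_kernel K" and "is_kernel L"
  shows "(K extreme_point_of kernel_interval 0 (K + L) \<longleftrightarrow>
            ex_kernel_interval K (K + L) \<subseteq> ex_kernel_interval 0 (K + L)) \<and>
         (K \<preceq>\<^sub>K L \<longrightarrow>
            (K \<in> ex_kernel_interval 0 L \<longleftrightarrow>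
              ex_kernel_interval K L \<subseteq> ex_kernel_interval 0 L))"
proof (intro conjI impI)
  show "K extreme_point_of kernel_interval 0 (K + L) \<longleftrightarrow>
      ex_kernel_interval K (K + L) \<subseteq> ex_kernel_interval 0 (K + L)"
    using assms by (rule extreme_iff_ex_kernel_interval_subset)
next
  assume "K \<preceq>\<^sub>K L"
  then have "is_kernel (L - K)" using assms by (simp add: is_kernel_diff_iff)
  moreover have "K + (L - K) = L" by simp
  ultimately show "K \<in> ex_kernel_interval 0 L \<longleftrightarrow>
      ex_kernel_interval K L \<subseteq> ex_kernel_interval 0 L"
    using extreme_iff_ex_kernel_interval_subset[OF assms(1), of "L - K"]
    by (simp add: ex_kernel_interval_def)
qed

end
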